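(* Let $n\ge 2$ and let the prices $X_1,\dots,X_n$ be i.i.d. with an absolutely continuous distribution $F$, presented in the order $X_1,\dots,X_n$. Let $T$ be the median of $F$, i.e. $\mathbb{P}(X_1<T)=\mathbb{P}(X_1\ge T)=1/2$. Then $\mathbb{E}(\mathrm{ALG}_T)\ge \frac12\,\mathbb{E}(\mathrm{OPT})$.
   Context: Trading-prophet problem: there are $n$ periods. In period $i$ the price $X_i$ is revealed. An agent starts in period 1 without the item and can hold at most one unit of it. In each period, immediately after observing the price, the agent may either buy the item at that price (reward $-X_i$) if she does not hold it, or sell it at that price (reward $+X_i$) if she holds it, or pass. The profit of an algorithm is its total reward. $\mathrm{OPT}$ is the maximum total reward achievable over all buy/sell decision sequences when the entire realized price sequence is known in advance. For $T\in\mathbb{R}$, $\mathrm{ALG}_T$ is the online algorithm which in each period $i<n$ buys if it does not hold the item and the price is $<T$, sells if it holds the item and the price is $\ge T$, and in period $n$ sells if it holds the item.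
   Formalization: With negative prices the literal claim fails (X uniform on [-11,-9], n=2), so it is proved for OPT when prices are a.s. nonnegative, and for any sign with OPT over sequences ending without the item, provided E(ALG_T) exists; expectations are extended-real. *)

theory Defs
  imports "HOL-Probability.Probability"
begin

datatype action = Buy | Sell | Pass

text \<open>The flag \<open>h\<close> below always says whether the agent currently holds the item.\<close>

fun allowed :: "bool \<Rightarrow> action \<Rightarrow> bool" where
  "allowed h Buy = (\<not> h)"
| "allowed h Sell = h"
| "allowed h Pass = True"

fun holds_after :: "bool \<Rightarrow> action \<Rightarrow> bool" where
  "holds_after h Buy = True"
| "holds_after h Sell = False"
| "holds_after h Pass = h"

fun reward :: "action \<Rightarrow> real \<Rightarrow> real" where
  "reward Buy x = - x"
| "reward Sell x = x"
| "reward Pass x = 0"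

fun feasible :: "bool \<Rightarrow> action list \<Rightarrow> bool" where
  "feasible h [] = True"
| "feasible h (a # as) = (allowed h a \<and> feasible (holds_after h a) as)"

definition holds_finally :: "bool \<Rightarrow> action list \<Rightarrow> bool" where
  "holds_finally h as = foldl holds_after h as"

definition total_reward :: "real list \<Rightarrow> action list \<Rightarrow> real" where
  "total_reward xs as = sum_list (map2 reward as xs)"

definition plans :: "nat \<Rightarrow> action list set" where
  "plans n = {as. length as = n \<and> feasible False as}"

definition OPT :: "real list \<Rightarrow> real" where
  "OPT xs = Max (total_reward xs ` plans (length xs))"

text \<open>If prices may be negative, \<open>OPT\<close> can buy at a negative price in the last period and keep
  the item, a reward that no trading accounts for: for prices in \<open>[-11, -9]\<close> it is at least
  \<open>9\<close>, while a plan that ends without the item earns at most \<open>2\<close> per trade.  For prices of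
  arbitrary sign, the benchmark is therefore the best plan that ends without the item; for
  nonnegative prices this is the same number, see \<open>OPT_eq_OPT_sold\<close>.\<close>

definition OPT_sold :: "real list \<Rightarrow> real" where
  "OPT_sold xs = Max (total_reward xs ` {as \<in> plans (length xs). \<not> holds_finally False as})"

text \<open>The list holds the prices of the current and all later periods, so a singleton list means
  that the current period is the last one; later prices have no other influence on an action.\<close>

fun threshold_plan :: "real \<Rightarrow> bool \<Rightarrow> real list \<Rightarrow> action list" where
  "threshold_plan T h [] = []"
| "threshold_plan T h [x] = [if h then Sell else Pass]"
| "threshold_plan T h (x # y # ys) =
     (let a = (if \<not> h \<and> x < T then Buy else if h \<and> x \<ge> T then Sell else Pass)
      in a # threshold_plan T (holds_after h a) (y # ys))"

definition ALG :: "real \<Rightarrow> real list \<Rightarrow> real" where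
  "ALG T xs = total_reward xs (threshold_plan T False xs)"

text \<open>Expectation with values in the extended reals, so that distributions without a finite mean
  are covered.  Since \<open>ennreal\<close> maps negative reals to \<open>0\<close>, the two integrals are those of the
  positive and the negative part.  The value is meaningful only if \<open>expectation_exists\<close> holds
  (in \<open>ereal\<close>, \<open>\<infinity> - \<infinity> = \<infinity>\<close>).\<close>

definition expectation_exists :: "'a measure \<Rightarrow> ('a \<Rightarrow> real) \<Rightarrow> bool" where
  "expectation_exists M f \<longleftrightarrow>
     (\<integral>\<^sup>+\<omega>. ennreal (f \<omega>) \<partial>M) < \<infinity> \<or> (\<integral>\<^sup>+\<omega>. ennreal (- f \<omega>) \<partial>M) < \<infinity>"

definition ext_expectation :: "'a measure \<Rightarrow> ('a \<Rightarrow> real) \<Rightarrow> ereal" where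
  "ext_expectation M f =
     enn2ereal (\<integral>\<^sup>+\<omega>. ennreal (f \<omega>) \<partial>M) - enn2ereal (\<integral>\<^sup>+\<omega>. ennreal (- f \<omega>) \<partial>M)"

lemma ext_expectation_integrable:
  assumes "integrable M f"
  shows "expectation_exists M f" "ext_expectation M f = ereal (integral\<^sup>L M f)"
proof -
  have a: "(\<integral>\<^sup>+\<omega>. ennreal (f \<omega>) \<partial>M) < \<infinity>" "(\<integral>\<^sup>+\<omega>. ennreal (- f \<omega>) \<partial>M) < \<infinity>"
    using assms by (auto simp: real_integrable_def top.not_eq_extremum)
  then show "expectation_exists M f" by (simp add: expectation_exists_def)
  obtain p q where p: "(\<integral>\<^sup>+\<omega>. ennreal (f \<omega>) \<partial>M) = ennreal p" "p \<ge> 0"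
    and q: "(\<integral>\<^sup>+\<omega>. ennreal (- f \<omega>) \<partial>M) = ennreal q" "q \<ge> 0"
    using a by (metis ennreal_cases infinity_ennreal_def less_irrefl)
  then show "ext_expectation M f = ereal (integral\<^sup>L M f)"
    by (simp add: ext_expectation_def real_lebesgue_integral_def[OF assms] enn2ereal_ennreal)
qed

lemma total_reward_Cons [simp]:
  "total_reward (x # xs) (a # as) = reward a x + total_reward xs as"
  by (simp add: total_reward_def)

lemma total_reward_Nil [simp]: "total_reward xs [] = 0"
  by (simp add: total_reward_def)

lemma finite_plans: "finite (plans n)"
proof -
  have "(UNIV :: action set) = {Buy, Sell, Pass}"
    using action.exhaust by auto
  then have "finite (UNIV :: action set)" by (metis finite.emptyI finite_insert)
  then have "finite {as :: action list. set as \<subseteq> UNIV \<and> length as = n}"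
    by (rule finite_lists_length_eq)
  then show ?thesis
    by (rule rev_finite_subset) (auto simp: plans_def)
qed

lemma threshold_plan_props:
  "length (threshold_plan T h xs) = length xs \<and> feasible h (threshold_plan T h xs) \<and>
   (xs \<noteq> [] \<longrightarrow> \<not> holds_finally h (threshold_plan T h xs))"
  by (induction T h xs rule: threshold_plan.induct) (auto simp: Let_def holds_finally_def)

lemma threshold_plan_sold:
  "threshold_plan T False xs \<in> {as \<in> plans (length xs). \<not> holds_finally False as}"
  using threshold_plan_props[of T False xs]
  by (cases xs) (auto simp: plans_def holds_finally_def)

lemma Pass_plan:
  "feasible h (replicate m Pass)" "holds_finally h (replicate m Pass) = h"
  "total_reward xs (replicate m Pass) = 0"
proof -
  show "feasible h (replicate m Pass)" by (induction m) auto
  show "holds_finally h (replicate m Pass) = h"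
    by (induction m) (auto simp: holds_finally_def)
  show "total_reward xs (replicate m Pass) = 0"
    by (induction m arbitrary: xs) (simp, case_tac xs, auto simp: total_reward_def)
qed

lemma improve_to_sold:
  assumes "length as = length xs" "feasible h as" "\<forall>x\<in>set xs. 0 \<le> x" "holds_finally h as"
  shows "\<exists>bs. length bs = length xs \<and> feasible h bs \<and>
    (bs = replicate (length xs) Pass \<or> \<not> holds_finally h bs) \<and>
    total_reward xs as \<le> total_reward xs bs"
  using assms
proof (induction xs arbitrary: as h)
  case Nil
  then show ?case by (auto simp: holds_finally_def)
next
  case (Cons x xs)
  then obtain a as' where as: "as = a # as'" by (cases as) auto
  have hf: "holds_finally k (c # cs) = holds_finally (holds_after k c) cs" for k c cs
    by (simp add: holds_finally_def)
  obtain bs where bs: "length bs = length xs" "feasible (holds_after h a) bs"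
    "total_reward xs as' \<le> total_reward xs bs"
    "bs = replicate (length xs) Pass \<or> \<not> holds_finally (holds_after h a) bs"
    using Cons.IH[of as' "holds_after h a"] Cons.prems by (auto simp: as hf)
  show ?case
  proof (cases "holds_finally (holds_after h a) bs")
    case False
    then show ?thesis using bs Cons.prems by (intro exI[of _ "a # bs"]) (auto simp: as hf)
  next
    case True
    then have b: "holds_after h a" "bs = replicate (length xs) Pass"
      using bs(4) by (auto simp: Pass_plan)
    have "total_reward (x # xs) as \<le> 0"
      using bs(3) b Cons.prems by (cases a) (auto simp: as Pass_plan)
    then show ?thesis
      using Pass_plan by (intro exI[of _ "replicate (length (x # xs)) Pass"]) (auto simp del: replicate_Suc)
  qed
qed

lemma OPT_eq_OPT_sold:
  assumes "\<forall>x\<in>set xs. 0 \<le> x"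
  shows "OPT xs = OPT_sold xs"
proof (rule antisym)
  let ?S = "{as \<in> plans (length xs). \<not> holds_finally False as}"
  have fin: "finite (total_reward xs ` ?S)" and fin': "finite (total_reward xs ` plans (length xs))"
    using finite_plans by auto
  have ne: "?S \<noteq> {}" using threshold_plan_sold by blast
  then show "OPT_sold xs \<le> OPT xs"
    unfolding OPT_def OPT_sold_def using fin' by (intro Max_mono) auto
  show "OPT xs \<le> OPT_sold xs"
    unfolding OPT_def
  proof (rule Max.boundedI[OF fin'])
    show "total_reward xs ` plans (length xs) \<noteq> {}" using ne by auto
    fix r assume "r \<in> total_reward xs ` plans (length xs)"
    then obtain as where as: "as \<in> plans (length xs)" "r = total_reward xs as" by auto
    obtain bs where "bs \<in> ?S" "r \<le> total_reward xs bs"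
    proof (cases "holds_finally False as")
      case False
      then show ?thesis using that as by auto
    next
      case True
      obtain bs where bs: "length bs = length xs" "feasible False bs"
        "bs = replicate (length xs) Pass \<or> \<not> holds_finally False bs"
        "total_reward xs as \<le> total_reward xs bs"
        using improve_to_sold[of as xs False] True as assms by (auto simp: plans_def)
      then have "\<not> holds_finally False bs" using Pass_plan(2) by metis
      then show ?thesis using that[of bs] bs as by (simp add: plans_def)
    qed
    then show "r \<le> OPT_sold xs"
      unfolding OPT_sold_def using Max_ge[OF fin] by (meson image_eqI order_trans)
  qed
qed

end

theory Submission
  imports Defs
begin

text \<open>After each period before the last, the threshold agent holds the item iff the current price
  is below \<open>T\<close>, so \<open>ALG\<close> collects \<open>X\<^sub>i\<^sub>+\<^sub>1 - X\<^sub>i\<close> over the periods with \<open>X\<^sub>i < T\<close>.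
  As \<open>T\<close> is the median, independence gives each of these \<open>n - 1\<close> terms half the expectation of
  \<open>\<bar>X\<^sub>1 - T\<bar>\<close>.  Any plan that ends without the item earns at most the sum of the \<open>n - 1\<close> terms
  \<open>(X\<^sub>i\<^sub>+\<^sub>1 - T)\<^sup>+ + (T - X\<^sub>i)\<^sup>+\<close>, each with the expectation of \<open>\<bar>X\<^sub>1 - T\<bar>\<close>.  If the latter is
  infinite, then so is that of the positive part of \<open>ALG\<close>, already on the event that only the
  first price is below \<open>T\<close>.\<close>

section \<open>Reward identities and bounds for a fixed price sequence\<close>

text \<open>Holding the item is valued at \<open>T\<close>: a purchase at \<open>x\<close> gains \<open>T - x\<close>, a sale gains \<open>x - T\<close>.\<close>

lemma total_reward_sold_le:
  assumes "length as = length (x # xs)" "feasible h as" "\<not> holds_finally h as"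
  shows "total_reward (x # xs) as \<le> (if h then T + max 0 (x - T) else 0) +
    (\<Sum>i<length xs. max 0 (xs ! i - T) + max 0 (T - (x # xs) ! i))"
  using assms
proof (induction xs arbitrary: x h as)
  case Nil
  then obtain a where "as = [a]" by (cases as) auto
  then show ?case using Nil by (cases a) (auto simp: holds_finally_def)
next
  case (Cons y ys)
  then obtain a bs where as: "as = a # bs" by (cases as) auto
  have "total_reward (y # ys) bs \<le> (if holds_after h a then T + max 0 (y - T) else 0) +
    (\<Sum>i<length ys. max 0 (ys ! i - T) + max 0 (T - (y # ys) ! i))"
    using Cons.prems by (intro Cons.IH) (auto simp: as holds_finally_def)
  \<comment> \<open>The new term at index \<open>0\<close> covers the allowance
    \<open>max 0 (y - T)\<close> in the induction hypothesis and, after a purchase, also the gain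
    \<open>T - x\<close>. A sale yields \<open>x\<close>, which is at most
    \<open>T + max 0 (x - T)\<close>.\<close>
  then show ?case
    using Cons.prems by (cases a) (auto simp: as sum.lessThan_Suc_shift simp del: sum.lessThan_Suc)
qed

text \<open>A held item is valued at the current price \<open>x\<close>. Whatever \<open>h\<close>
  is, the item is held after a non-final period iff \<open>x < T\<close>, and its value then changes
  by the next price minus \<open>x\<close>; hence \<open>h\<close> enters only through the initial
  value.\<close>

lemma total_reward_threshold_plan:
  "total_reward (x # xs) (threshold_plan T h (x # xs)) = (if h then x else 0) +
    (\<Sum>i<length xs. if (x # xs) ! i < T then xs ! i - (x # xs) ! i else 0)"
proof (induction xs arbitrary: x h)
  case (Cons y ys)
  show ?case
    by (auto simp: Let_def Cons.IH sum.lessThan_Suc_shift simp del: sum.lessThan_Suc cong: if_cong)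
qed auto

lemma map_upt_Suc_Cons: "map x [1..<Suc (Suc m)] = x 1 # map x [2..<Suc (Suc m)]"
  for x :: "nat \<Rightarrow> 'b"
  by (subst upt_conv_Cons) (simp_all add: numeral_2_eq_2 del: upt_Suc)

text \<open>Translates between periods, counted from 1, and list positions, counted from 0.\<close>

lemma sum_atLeast1_lessThan: "(\<Sum>i\<in>{1..<Suc m}. g i) = (\<Sum>i<m. g (Suc i))"
  for g :: "nat \<Rightarrow> real"
  by (simp add: lessThan_atLeast0 sum.shift_bounds_Suc_ivl[symmetric] del: sum.op_ivl_Suc)

lemma ALG_eq_sum:
  fixes x :: "nat \<Rightarrow> real"
  assumes "n \<ge> 1"
  shows "ALG T (map x [1..<Suc n]) = (\<Sum>i\<in>{1..<n}. if x i < T then x (Suc i) - x i else 0)"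
proof -
  obtain m where n: "n = Suc m" using assms by (cases n) auto
  show ?thesis
    unfolding n map_upt_Suc_Cons ALG_def total_reward_threshold_plan sum_atLeast1_lessThan
    by (auto intro!: sum.cong simp: nth_Cons' simp del: upt_Suc)
qed

lemma OPT_sold_le_sum:
  fixes x :: "nat \<Rightarrow> real"
  assumes "n \<ge> 1"
  shows "OPT_sold (map x [1..<Suc n]) \<le> (\<Sum>i\<in>{1..<n}. max 0 (x (Suc i) - T) + max 0 (T - x i))"
proof -
  obtain m where n: "n = Suc m" using assms by (cases n) auto
  let ?xs = "x 1 # map x [2..<Suc (Suc m)]"
  have *: "(\<Sum>i<length (map x [2..<Suc (Suc m)]).
        max 0 (map x [2..<Suc (Suc m)] ! i - T) + max 0 (T - ?xs ! i))
      = (\<Sum>i<m. max 0 (x (Suc (Suc i)) - T) + max 0 (T - x (Suc i)))"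
    by (auto intro!: sum.cong simp: nth_Cons' simp del: upt_Suc)
  show ?thesis
    unfolding n map_upt_Suc_Cons OPT_sold_def sum_atLeast1_lessThan *[symmetric]
  proof (rule Max.boundedI)
    show "total_reward ?xs ` {as \<in> plans (length ?xs). \<not> holds_finally False as} \<noteq> {}"
      using threshold_plan_sold by blast
  next
    fix r assume "r \<in> total_reward ?xs ` {as \<in> plans (length ?xs). \<not> holds_finally False as}"
    then obtain as where "r = total_reward ?xs as" "length as = length ?xs" "feasible False as"
      "\<not> holds_finally False as"
      by (auto simp: plans_def)
    then show "r \<le> (\<Sum>i<length (map x [2..<Suc (Suc m)]).
        max 0 (map x [2..<Suc (Suc m)] ! i - T) + max 0 (T - ?xs ! i))"
      using total_reward_sold_le[of as "x 1" "map x [2..<Suc (Suc m)]" False T] by (simp del: upt_Suc)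
  qed (use finite_plans in auto)
qed

text \<open>Never trading is a plan that ends without the item. The bound makes the negative part of
  \<open>OPT_sold\<close> vanish in its extended expectation.\<close>

lemma OPT_sold_nonneg: "0 \<le> OPT_sold xs"
  unfolding OPT_sold_def
proof (rule Max_ge)
  let ?as = "replicate (length xs) Pass"
  have "?as \<in> {as \<in> plans (length xs). \<not> holds_finally False as}"
    using Pass_plan by (auto simp: plans_def)
  then show "0 \<in> total_reward xs ` {as \<in> plans (length xs). \<not> holds_finally False as}"
    using Pass_plan(3)[of xs "length xs"] by (metis image_eqI)
qed (use finite_plans in auto)

section \<open>Comparing extended expectations\<close>

lemma ext_expectation_cong_AE:
  assumes "AE \<omega> in M. f \<omega> = g \<omega>"
  shows "ext_expectation M f = ext_expectation M g"
proof -
  have "(\<integral>\<^sup>+\<omega>. ennreal (f \<omega>) \<partial>M) = (\<integral>\<^sup>+\<omega>. ennreal (g \<omega>) \<partial>M)"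
    "(\<integral>\<^sup>+\<omega>. ennreal (- f \<omega>) \<partial>M) = (\<integral>\<^sup>+\<omega>. ennreal (- g \<omega>) \<partial>M)"
    using assms by (auto intro!: nn_integral_cong_AE)
  then show ?thesis by (simp add: ext_expectation_def)
qed

text \<open>Nonnegative integrals are monotone for arbitrary functions, so the bound applies to
  \<open>OPT_sold\<close> without a proof that it is measurable.\<close>

lemma ext_expectation_le_integral:
  assumes "integrable M g" "\<And>\<omega>. 0 \<le> f \<omega>" "\<And>\<omega>. f \<omega> \<le> g \<omega>"
  shows "ext_expectation M f \<le> ereal (integral\<^sup>L M g)"
proof -
  have g: "0 \<le> g \<omega>" for \<omega> using assms order_trans by blast
  have "(\<integral>\<^sup>+\<omega>. ennreal (f \<omega>) \<partial>M) \<le> (\<integral>\<^sup>+\<omega>. ennreal (g \<omega>) \<partial>M)"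
    using assms by (intro nn_integral_mono ennreal_leI) auto
  also have "\<dots> = ennreal (integral\<^sup>L M g)"
    using assms(1) g by (intro nn_integral_eq_integral) auto
  finally have *: "enn2ereal (\<integral>\<^sup>+\<omega>. ennreal (f \<omega>) \<partial>M) \<le> ereal (integral\<^sup>L M g)"
    using g Bochner_Integration.integral_nonneg[of M g] by (simp add: less_eq_ennreal.rep_eq)
  have "(\<integral>\<^sup>+\<omega>. ennreal (- f \<omega>) \<partial>M) = 0"
    using assms(2) by (simp add: ennreal_neg)
  with * show ?thesis by (simp add: ext_expectation_def zero_ennreal.rep_eq)
qed

section \<open>Independent prices with a common law and median \<open>T\<close>\<close>

locale median_prices = prob_space M for M :: "'a measure" +
  fixes X :: "nat \<Rightarrow> 'a \<Rightarrow> real" and F :: "real measure" and n :: nat and T :: real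
  assumes n_ge_2: "n \<ge> 2"
    and indep_X: "indep_vars (\<lambda>_. borel) X {1..n}"
    and distr_X: "i \<in> {1..n} \<Longrightarrow> distr M borel (X i) = F"
    and prob_less: "\<P>(\<omega> in M. X 1 \<omega> < T) = 1 / 2"
    and prob_ge: "\<P>(\<omega> in M. X 1 \<omega> \<ge> T) = 1 / 2"
begin

abbreviation prices :: "'a \<Rightarrow> real list" where
  "prices \<omega> \<equiv> map (\<lambda>i. X i \<omega>) [1..<Suc n]"

lemma X_measurable: "i \<in> {1..n} \<Longrightarrow> X i \<in> borel_measurable M"
  using indep_X by (auto simp: indep_vars_def)

text \<open>Both sides are the integral of \<open>g\<close> with respect to the common law
  \<open>F\<close>. The next two lemmas transfer integrability and expectation in the same
  way.\<close>

lemma nn_integral_X: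
  assumes "i \<in> {1..n}" "g \<in> borel_measurable borel"
  shows "(\<integral>\<^sup>+\<omega>. g (X i \<omega>) \<partial>M) = (\<integral>\<^sup>+\<omega>. g (X 1 \<omega>) \<partial>M)"
  using assms nn_integral_distr[of "X i" M borel g] nn_integral_distr[of "X 1" M borel g]
    X_measurable[of i] X_measurable[of 1] distr_X[of i] distr_X[of 1] n_ge_2
  by auto

lemma integrable_X_iff:
  fixes g :: "real \<Rightarrow> real"
  assumes "i \<in> {1..n}" "g \<in> borel_measurable borel"
  shows "integrable M (\<lambda>\<omega>. g (X i \<omega>)) \<longleftrightarrow> integrable M (\<lambda>\<omega>. g (X 1 \<omega>))"
  using assms integrable_distr_eq[of "X i" M borel g] integrable_distr_eq[of "X 1" M borel g]
    X_measurable[of i] X_measurable[of 1] distr_X[of i] distr_X[of 1] n_ge_2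
  by auto

lemma expectation_X:
  fixes g :: "real \<Rightarrow> real"
  assumes "i \<in> {1..n}" "g \<in> borel_measurable borel"
  shows "expectation (\<lambda>\<omega>. g (X i \<omega>)) = expectation (\<lambda>\<omega>. g (X 1 \<omega>))"
  using assms integral_distr[of "X i" M borel g] integral_distr[of "X 1" M borel g]
    X_measurable[of i] X_measurable[of 1] distr_X[of i] distr_X[of 1] n_ge_2
  by auto

lemma expectation_indicator_less:
  assumes "i \<in> {1..n}"
  shows "expectation (\<lambda>\<omega>. indicator {..<T} (X i \<omega>)) = (1 / 2 :: real)"
proof -
  have "expectation (\<lambda>\<omega>. indicator {..<T} (X i \<omega>) :: real)
      = expectation (\<lambda>\<omega>. indicator {..<T} (X 1 \<omega>))"
    using assms by (intro expectation_X) auto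
  also have "\<dots> = expectation (indicator {\<omega> \<in> space M. X 1 \<omega> < T})"
    by (intro Bochner_Integration.integral_cong) (auto simp: indicator_def)
  also have "\<dots> = 1 / 2"
    using prob_less X_measurable[of 1] n_ge_2 by (subst Bochner_Integration.integral_indicator) auto
  finally show ?thesis .
qed

lemma nn_integral_indicator_less: "(\<integral>\<^sup>+\<omega>. indicator {..<T} (X 1 \<omega>) \<partial>M) = ennreal (1 / 2)"
proof -
  have "(\<integral>\<^sup>+\<omega>. indicator {..<T} (X 1 \<omega>) \<partial>M) = (\<integral>\<^sup>+\<omega>. indicator {\<omega> \<in> space M. X 1 \<omega> < T} \<omega> \<partial>M)"
    by (intro nn_integral_cong) (auto simp: indicator_def)
  also have "\<dots> = emeasure M {\<omega> \<in> space M. X 1 \<omega> < T}"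
    using X_measurable[of 1] n_ge_2 by (intro nn_integral_indicator) auto
  also have "\<dots> = ennreal (1 / 2)"
    by (simp only: emeasure_eq_measure prob_less)
  finally show ?thesis .
qed

lemma nn_integral_indicator_ge:
  assumes "i \<in> {1..n}"
  shows "(\<integral>\<^sup>+\<omega>. indicator {T..} (X i \<omega>) \<partial>M) = ennreal (1 / 2)"
proof -
  have "(\<integral>\<^sup>+\<omega>. indicator {T..} (X i \<omega>) \<partial>M) = (\<integral>\<^sup>+\<omega>. indicator {T..} (X 1 \<omega>) \<partial>M)"
    using assms by (intro nn_integral_X) auto
  also have "\<dots> = (\<integral>\<^sup>+\<omega>. indicator {\<omega> \<in> space M. X 1 \<omega> \<ge> T} \<omega> \<partial>M)"
    by (intro nn_integral_cong) (auto simp: indicator_def)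
  also have "\<dots> = emeasure M {\<omega> \<in> space M. X 1 \<omega> \<ge> T}"
    using X_measurable[of 1] n_ge_2 by (intro nn_integral_indicator) auto
  also have "\<dots> = ennreal (1 / 2)"
    by (simp only: emeasure_eq_measure prob_ge)
  finally show ?thesis .
qed

section \<open>Prices without a finite mean\<close>

text \<open>By independence, the product of the integrals is the integral of the product. Any
  minorant of the positive part of \<open>ALG\<close> that factors over the periods thus gives a
  computable lower bound.\<close>

lemma nn_integral_ALG_ge_prod:
  fixes g :: "nat \<Rightarrow> real \<Rightarrow> ennreal"
  assumes "\<And>i. g i \<in> borel_measurable borel"
    and "\<And>x. (\<Prod>i\<in>{1..n}. g i (x i)) \<le> ennreal (ALG T (map x [1..<Suc n]))"
  shows "(\<Prod>i\<in>{1..n}. \<integral>\<^sup>+\<omega>. g i (X i \<omega>) \<partial>M) \<le> (\<integral>\<^sup>+\<omega>. ennreal (ALG T (prices \<omega>)) \<partial>M)"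
proof -
  have "indep_vars (\<lambda>_. borel) (\<lambda>i \<omega>. g i (X i \<omega>)) {1..n}"
    using assms(1) by (intro indep_vars_compose2[OF indep_X]) auto
  then have "(\<Prod>i\<in>{1..n}. \<integral>\<^sup>+\<omega>. g i (X i \<omega>) \<partial>M) = (\<integral>\<^sup>+\<omega>. (\<Prod>i\<in>{1..n}. g i (X i \<omega>)) \<partial>M)"
    by (intro indep_vars_nn_integral[symmetric]) auto
  also have "\<dots> \<le> (\<integral>\<^sup>+\<omega>. ennreal (ALG T (prices \<omega>)) \<partial>M)"
    using assms(2) by (intro nn_integral_mono) auto
  finally show ?thesis .
qed

text \<open>In the sum for \<open>ALG\<close> only the term of period 1 survives.\<close>

lemma ALG_one_below:
  fixes x :: "nat \<Rightarrow> real"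
  assumes "x 1 < T" "\<And>i. i \<in> {2..n} \<Longrightarrow> T \<le> x i"
  shows "ALG T (map x [1..<Suc n]) = x 2 - x 1"
proof -
  have "ALG T (map x [1..<Suc n]) = (\<Sum>i\<in>{1..<n}. if x i < T then x (Suc i) - x i else 0)"
    using n_ge_2 by (intro ALG_eq_sum) auto
  also have "\<dots> = (\<Sum>i\<in>{1}. if x i < T then x (Suc i) - x i else 0)"
  proof (intro sum.mono_neutral_right ballI)
    fix i assume "i \<in> {1..<n} - {1}"
    then show "(if x i < T then x (Suc i) - x i else 0) = 0"
      using assms(2)[of i] by auto
  qed (use n_ge_2 in auto)
  finally show ?thesis using assms(1) by (simp add: numeral_2_eq_2)
qed

lemma prod_split_1_2:
  fixes f :: "nat \<Rightarrow> ennreal"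
  shows "(\<Prod>i\<in>{1..n}. f i) = f 1 * f 2 * (\<Prod>i\<in>{3..n}. f i)"
proof -
  have "{1..n} = insert 1 (insert 2 {3..n})" using n_ge_2 by auto
  then show ?thesis by (simp add: mult.assoc)
qed

text \<open>The first two conditions confine the product to the event that only the first price is
  below \<open>T\<close>. There the factors from period 3 on are 1, and \<open>g 1\<close> and
  \<open>g 2\<close> together stay below \<open>x 2 - x 1\<close>, the profit on this event.\<close>

lemma prod_le_ALG:
  fixes g :: "nat \<Rightarrow> real \<Rightarrow> ennreal" and x :: "nat \<Rightarrow> real"
  assumes "\<And>y. T \<le> y \<Longrightarrow> g 1 y = 0"
    and "\<And>i y. \<lbrakk>2 \<le> i; y < T\<rbrakk> \<Longrightarrow> g i y = 0"
    and "\<And>i y. \<lbrakk>3 \<le> i; T \<le> y\<rbrakk> \<Longrightarrow> g i y = 1"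
    and "\<And>y z. \<lbrakk>y < T; T \<le> z\<rbrakk> \<Longrightarrow> g 1 y * g 2 z \<le> ennreal (z - y)"
  shows "(\<Prod>i\<in>{1..n}. g i (x i)) \<le> ennreal (ALG T (map x [1..<Suc n]))"
proof (cases "x 1 < T \<and> (\<forall>i\<in>{2..n}. T \<le> x i)")
  case True
  then have "(\<Prod>i\<in>{3..n}. g i (x i)) = 1"
    using assms(3) by (intro prod.neutral) auto
  then show ?thesis
    using True assms(4)[of "x 1" "x 2"] n_ge_2 ALG_one_below[of x]
    by (simp add: prod_split_1_2 del: upt_Suc One_nat_def)
next
  case False
  then consider "T \<le> x 1" | i where "i \<in> {2..n}" "x i < T" by force
  then have "\<exists>i\<in>{1..n}. g i (x i) = 0"
  proof cases
    case 1
    then show ?thesis using assms(1) n_ge_2 by (intro bexI[of _ 1]) auto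
  next
    case 2
    then show ?thesis using assms(2) by (intro bexI[of _ i]) auto
  qed
  then have "(\<Prod>i\<in>{1..n}. g i (x i)) = 0" by (intro prod_zero) auto
  then show ?thesis by (simp only: zero_le)
qed

lemma nn_integral_ALG_infinite:
  assumes "\<not> integrable M (X 1)"
  shows "(\<integral>\<^sup>+\<omega>. ennreal (ALG T (prices \<omega>)) \<partial>M) = \<infinity>"
proof -
  \<comment> \<open>As \<open>ennreal\<close> cuts off negative values, these are the expectations
    of the two parts of \<open>X 1 - T\<close>. A constant is integrable on a probability space, so
    they cannot both be finite.\<close>
  define A B where "A = (\<integral>\<^sup>+\<omega>. ennreal (T - X 1 \<omega>) \<partial>M)"
    and "B = (\<integral>\<^sup>+\<omega>. ennreal (X 1 \<omega> - T) \<partial>M)"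
  have "A = \<infinity> \<or> B = \<infinity>"
  proof (rule ccontr)
    assume "\<not> (A = \<infinity> \<or> B = \<infinity>)"
    then have "integrable M (\<lambda>\<omega>. X 1 \<omega> - T)"
      using X_measurable[of 1] n_ge_2 unfolding real_integrable_def A_def B_def by auto
    then have "integrable M (\<lambda>\<omega>. (X 1 \<omega> - T) + T)"
      by (intro Bochner_Integration.integrable_add) auto
    then show False using assms by simp
  qed
  then show ?thesis
  proof
    assume "A = \<infinity>"
    \<comment> \<open>The minorant uses \<open>x 2 - x 1 \<ge> T - x 1\<close> for
      \<open>x 2 \<ge> T\<close>. The factor \<open>ennreal (T - x)\<close> vanishes by itself for
      \<open>x \<ge> T\<close>.\<close>
    define g :: "nat \<Rightarrow> real \<Rightarrow> ennreal" where
      "g i = (if i = 1 then (\<lambda>x. ennreal (T - x)) else indicator {T..})" for i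
    \<comment> \<open>Every factor other than the first is 1/2, so the infinite one decides.\<close>
    have "(\<Prod>i\<in>{1..n}. \<integral>\<^sup>+\<omega>. g i (X i \<omega>) \<partial>M) = \<infinity>"
      using \<open>A = \<infinity>\<close> n_ge_2 unfolding prod_split_1_2
      by (auto simp: g_def A_def nn_integral_indicator_ge ennreal_mult_top ennreal_top_mult)
    then show ?thesis
      using nn_integral_ALG_ge_prod[of g] prod_le_ALG[of g]
      by (auto simp: g_def ennreal_neg intro!: ennreal_leI simp: top_unique)
  next
    assume "B = \<infinity>"
    \<comment> \<open>Symmetric choice: for \<open>x 1 < T\<close> the profit
      \<open>x 2 - x 1\<close> is at least \<open>x 2 - T\<close>, so the infinite factor now
      belongs to period 2.\<close>
    define g :: "nat \<Rightarrow> real \<Rightarrow> ennreal" where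
      "g i = (if i = 1 then indicator {..<T}
        else if i = 2 then (\<lambda>x. ennreal (x - T)) else indicator {T..})" for i
    have "(\<integral>\<^sup>+\<omega>. ennreal (X 2 \<omega> - T) \<partial>M) = \<infinity>"
      using nn_integral_X[of 2 "\<lambda>x. ennreal (x - T)"] \<open>B = \<infinity>\<close> n_ge_2 by (auto simp: B_def)
    then have "(\<Prod>i\<in>{1..n}. \<integral>\<^sup>+\<omega>. g i (X i \<omega>) \<partial>M) = \<infinity>"
      unfolding prod_split_1_2
      by (auto simp: g_def nn_integral_indicator_ge nn_integral_indicator_less ennreal_mult_top
          ennreal_top_mult simp del: One_nat_def)
    then show ?thesis
      using nn_integral_ALG_ge_prod[of g] prod_le_ALG[of g]
      by (auto simp: g_def ennreal_neg intro!: ennreal_leI simp: top_unique)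
  qed
qed

section \<open>Prices with a finite mean\<close>

text \<open>With \<open>p\<close> and \<open>q\<close> the expectations of the two parts of
  \<open>X 1 - T\<close>, each of the \<open>n - 1\<close> terms of \<open>ALG\<close> has mean
  \<open>(p + q) / 2\<close>, and each term of the bound on \<open>OPT_sold\<close> has mean
  \<open>p + q\<close>.\<close>

lemma ext_expectation_ALG_integrable:
  assumes "integrable M (X 1)"
  shows "1 / 2 * ext_expectation M (\<lambda>\<omega>. OPT_sold (prices \<omega>)) \<le> ext_expectation M (\<lambda>\<omega>. ALG T (prices \<omega>))"
proof -
  define p q where "p = expectation (\<lambda>\<omega>. max 0 (X 1 \<omega> - T))"
    and "q = expectation (\<lambda>\<omega>. max 0 (T - X 1 \<omega>))"
  have int_p: "integrable M (\<lambda>\<omega>. max 0 (X i \<omega> - T))"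
    and int_q: "integrable M (\<lambda>\<omega>. max 0 (T - X i \<omega>))"
    and int_d: "integrable M (\<lambda>\<omega>. X i \<omega> - T)"
    and E_p: "expectation (\<lambda>\<omega>. max 0 (X i \<omega> - T)) = p"
    and E_q: "expectation (\<lambda>\<omega>. max 0 (T - X i \<omega>)) = q" if "i \<in> {1..n}" for i
  proof -
    have "integrable M (X i)"
      using that assms integrable_X_iff[of i "\<lambda>x. x"] by simp
    then show "integrable M (\<lambda>\<omega>. max 0 (X i \<omega> - T))" "integrable M (\<lambda>\<omega>. max 0 (T - X i \<omega>))"
      "integrable M (\<lambda>\<omega>. X i \<omega> - T)"
      by auto
    show "expectation (\<lambda>\<omega>. max 0 (X i \<omega> - T)) = p" "expectation (\<lambda>\<omega>. max 0 (T - X i \<omega>)) = q"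
      using that expectation_X[of i "\<lambda>x. max 0 (x - T)"] expectation_X[of i "\<lambda>x. max 0 (T - x)"]
      by (auto simp: p_def q_def)
  qed
  have E_d: "expectation (\<lambda>\<omega>. X i \<omega> - T) = p - q" if "i \<in> {1..n}" for i
  proof -
    have "expectation (\<lambda>\<omega>. X i \<omega> - T)
        = expectation (\<lambda>\<omega>. max 0 (X i \<omega> - T) - max 0 (T - X i \<omega>))"
      by (intro Bochner_Integration.integral_cong) auto
    then show ?thesis
      using that by (simp add: int_p int_q E_p E_q)
  qed
  have term_ALG: "integrable M (\<lambda>\<omega>. if X i \<omega> < T then X (Suc i) \<omega> - X i \<omega> else 0)"
    "expectation (\<lambda>\<omega>. if X i \<omega> < T then X (Suc i) \<omega> - X i \<omega> else 0) = (p + q) / 2"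
    if i: "i \<in> {1..<n}" for i
  proof -
    have i': "i \<in> {1..n}" "Suc i \<in> {1..n}" using i by auto
    define Y :: "nat \<Rightarrow> real \<Rightarrow> real" where
      "Y k = (if k = i then indicator {..<T} else (\<lambda>x. x - T))" for k
    have "indep_vars (\<lambda>_. borel) (\<lambda>k \<omega>. Y k (X k \<omega>)) {1..n}"
      by (intro indep_vars_compose2[OF indep_X]) (auto simp: Y_def)
    \<comment> \<open>The product rule for independent variables multiplies over the whole index
      set, so the family is cut down to the two periods involved.\<close>
    then have ind: "indep_vars (\<lambda>_. borel) (\<lambda>k \<omega>. Y k (X k \<omega>)) {i, Suc i}"
      using i' by (rule_tac indep_vars_subset) auto
    have intY: "integrable M (\<lambda>\<omega>. Y k (X k \<omega>))" if "k \<in> {i, Suc i}" for k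
    proof (cases "k = i")
      case True
      show ?thesis
        using X_measurable[OF i'(1)] unfolding True Y_def
        by (intro integrable_const_bound[where B = 1]) (auto simp: indicator_def)
    qed (use that int_d[OF i'(2)] in \<open>auto simp: Y_def\<close>)
    have prod_eq: "(\<Prod>k\<in>{i, Suc i}. Y k (X k \<omega>)) = indicator {..<T} (X i \<omega>) * (X (Suc i) \<omega> - T)" for \<omega>
      by (simp add: Y_def)
    have 1: "integrable M (\<lambda>\<omega>. indicator {..<T} (X i \<omega>) * (X (Suc i) \<omega> - T))"
      using indep_vars_integrable[OF _ ind intY] by (simp add: prod_eq)
    have 2: "expectation (\<lambda>\<omega>. indicator {..<T} (X i \<omega>) * (X (Suc i) \<omega> - T)) = 1 / 2 * (p - q)"
      using indep_vars_lebesgue_integral[OF _ ind intY] i'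
      by (simp add: Y_def E_d expectation_indicator_less)
    \<comment> \<open>Inserting \<open>T\<close> splits the increment into a product of functions of
      two different prices, of mean \<open>(p - q) / 2\<close>, and a function of \<open>X i\<close>
      alone, of mean \<open>q\<close>.\<close>
    have eq: "(if X i \<omega> < T then X (Suc i) \<omega> - X i \<omega> else 0)
        = indicator {..<T} (X i \<omega>) * (X (Suc i) \<omega> - T) + max 0 (T - X i \<omega>)" for \<omega>
      by (auto simp: indicator_def)
    show "integrable M (\<lambda>\<omega>. if X i \<omega> < T then X (Suc i) \<omega> - X i \<omega> else 0)"
      unfolding eq using 1 int_q i' by simp
    show "expectation (\<lambda>\<omega>. if X i \<omega> < T then X (Suc i) \<omega> - X i \<omega> else 0) = (p + q) / 2"
      unfolding eq using 1 2 int_q i' E_q by (simp add: add_divide_distrib diff_divide_distrib)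
  qed
  have ALG: "ALG T (prices \<omega>) = (\<Sum>i\<in>{1..<n}. if X i \<omega> < T then X (Suc i) \<omega> - X i \<omega> else 0)" for \<omega>
    using n_ge_2 by (intro ALG_eq_sum) auto
  have "integrable M (\<lambda>\<omega>. ALG T (prices \<omega>))"
    unfolding ALG using term_ALG(1) by (intro Bochner_Integration.integrable_sum) auto
  moreover have "expectation (\<lambda>\<omega>. ALG T (prices \<omega>)) = (\<Sum>i\<in>{1..<n}. (p + q) / 2)"
    unfolding ALG by (simp add: term_ALG Bochner_Integration.integral_sum)
  ultimately have E_ALG: "ext_expectation M (\<lambda>\<omega>. ALG T (prices \<omega>))
      = ereal (real (n - 1) * (p + q) / 2)"
    by (simp add: ext_expectation_integrable del: upt_Suc)
  have "ext_expectation M (\<lambda>\<omega>. OPT_sold (prices \<omega>))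
      \<le> ereal (expectation (\<lambda>\<omega>. \<Sum>i\<in>{1..<n}. max 0 (X (Suc i) \<omega> - T) + max 0 (T - X i \<omega>)))"
    using n_ge_2
    by (intro ext_expectation_le_integral OPT_sold_nonneg OPT_sold_le_sum
        Bochner_Integration.integrable_sum Bochner_Integration.integrable_add int_p int_q) auto
  also have "expectation (\<lambda>\<omega>. \<Sum>i\<in>{1..<n}. max 0 (X (Suc i) \<omega> - T) + max 0 (T - X i \<omega>))
      = (\<Sum>i\<in>{1..<n}. p + q)"
    by (subst Bochner_Integration.integral_sum) (auto simp: int_p int_q E_p E_q)
  finally have "ext_expectation M (\<lambda>\<omega>. OPT_sold (prices \<omega>)) \<le> ereal (real (n - 1) * (p + q))"
    by simp
  then have "ereal (1 / 2) * ext_expectation M (\<lambda>\<omega>. OPT_sold (prices \<omega>))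
      \<le> ereal (1 / 2) * ereal (real (n - 1) * (p + q))"
    by (intro ereal_mult_left_mono) auto
  moreover have "(1 / 2 :: ereal) = ereal (1 / 2)"
    by (simp only: one_ereal_def numeral_eq_ereal ereal_divide) simp
  ultimately show ?thesis by (simp add: E_ALG del: upt_Suc One_nat_def)
qed

section \<open>Combining the two cases\<close>

lemma ext_expectation_ALG_ge:
  "1 / 2 * ext_expectation M (\<lambda>\<omega>. OPT_sold (prices \<omega>)) \<le> ext_expectation M (\<lambda>\<omega>. ALG T (prices \<omega>))"
proof (cases "integrable M (X 1)")
  case False
  \<comment> \<open>In \<open>ereal\<close>, infinity minus anything is infinity, so the infinite
    positive part fixes the value whatever the negative part is.\<close>
  then have "ext_expectation M (\<lambda>\<omega>. ALG T (prices \<omega>)) = \<infinity>"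
    unfolding ext_expectation_def nn_integral_ALG_infinite[OF False] by simp
  then show ?thesis by simp
qed (rule ext_expectation_ALG_integrable)

end

theorem theorem1:
  fixes M :: "'a measure" and X :: "nat \<Rightarrow> 'a \<Rightarrow> real" and F :: "real measure"
    and n :: nat and T :: real
  defines "prices \<equiv> \<lambda>\<omega>. map (\<lambda>i. X i \<omega>) [1..<Suc n]"
  assumes "n \<ge> 2"
    and "prob_space M"
    and "prob_space.indep_vars M (\<lambda>_. borel) X {1..n}"
    and "\<forall>i\<in>{1..n}. distr M borel (X i) = F"
    and "absolutely_continuous lborel F"
    and "\<P>(\<omega> in M. X 1 \<omega> < T) = 1 / 2"
    and "\<P>(\<omega> in M. X 1 \<omega> \<ge> T) = 1 / 2"
  shows "((AE \<omega> in M. \<forall>i\<in>{1..n}. 0 \<le> X i \<omega>) \<longrightarrow>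
            ext_expectation M (\<lambda>\<omega>. ALG T (prices \<omega>)) \<ge> 1 / 2 * ext_expectation M (\<lambda>\<omega>. OPT (prices \<omega>)))
       \<and> (expectation_exists M (\<lambda>\<omega>. ALG T (prices \<omega>)) \<longrightarrow>
            ext_expectation M (\<lambda>\<omega>. ALG T (prices \<omega>)) \<ge> 1 / 2 * ext_expectation M (\<lambda>\<omega>. OPT_sold (prices \<omega>)))"
proof -
  interpret median_prices M X F n T
    using assms(2-5,7,8) by (simp add: median_prices_def median_prices_axioms_def)
  \<comment> \<open>Almost surely nonnegative prices make the two benchmarks agree almost surely,
    which reduces the first claim to the inequality for \<open>OPT_sold\<close>.\<close>
  have "ext_expectation M (\<lambda>\<omega>. OPT (prices \<omega>)) = ext_expectation M (\<lambda>\<omega>. OPT_sold (prices \<omega>))"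
    if nonneg: "AE \<omega> in M. \<forall>i\<in>{1..n}. 0 \<le> X i \<omega>"
  proof (rule ext_expectation_cong_AE)
    show "AE \<omega> in M. OPT (prices \<omega>) = OPT_sold (prices \<omega>)"
      using nonneg
    proof eventually_elim
      case (elim \<omega>)
      then show ?case
        unfolding prices_def by (intro OPT_eq_OPT_sold) (auto simp del: upt_Suc)
    qed
  qed
  then show ?thesis
    using ext_expectation_ALG_ge unfolding prices_def by (simp del: upt_Suc)
qed

end
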